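(* Let $k,m,n\in\mathbb{Z}$ and let $$N=\begin{pmatrix}8k+1&2m+1\\0&8n+5\end{pmatrix}\quad\text{or}\quad N=\begin{pmatrix}8k+5&2m+1\\0&8n+1\end{pmatrix}\in UT_2(\mathbb{Z}).$$ Then there are no four matrices in $UT_2(\mathbb{Z})$ having the Jordan $D(N)$-property. Consequently, there is no upper-triangular Jordan $D(N)$-quadruple.
   Context: $UT_2(\mathbb{Z})$ denotes the ring of upper-triangular $2\times 2$ integer matrices, and $A\circ B=\frac12(AB+BA)$ (computed over $\mathbb{Q}$) is the Jordan product. For $N\in UT_2(\mathbb{Z})$, four matrices $A_1,A_2,A_3,A_4\in UT_2(\mathbb{Z})$ (not necessarily distinct or nonzero) have the Jordan $D(N)$-property if for every $1\le i<j\le 4$ there exists $X_{ij}\in UT_2(\mathbb{Z})$ with $A_i\circ A_j+N=X_{ij}^2$. If moreover the $A_i$ are distinct and nonzero, then $\{A_1,A_2,A_3,A_4\}$ is called an upper-triangular Jordan $D(N)$-quadruple. *)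

theory Defs
  imports "Jordan_Normal_Form.Matrix"
begin

definition UT2 :: "int mat set" where
  "UT2 = {A \<in> carrier_mat 2 2. upper_triangular A}"

definition jordan_prod :: "rat mat \<Rightarrow> rat mat \<Rightarrow> rat mat" where
  "jordan_prod A B = (1 / 2) \<cdot>\<^sub>m (A * B + B * A)"

abbreviation to_rat_mat :: "int mat \<Rightarrow> rat mat" where
  "to_rat_mat \<equiv> map_mat rat_of_int"

text \<open>The four matrices are the values of \<open>A\<close> at the indices 1 to 4, so repetitions and
  zero matrices are allowed; the values at all other indices are irrelevant. The equation is
  one between rational matrices, since the Jordan product of two integer matrices need not be
  integral.\<close>

definition jordan_D_property :: "int mat \<Rightarrow> (nat \<Rightarrow> int mat) \<Rightarrow> bool" where
  "jordan_D_property N A \<longleftrightarrow>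
     (\<forall>i\<in>{1..4}. A i \<in> UT2) \<and>
     (\<forall>i j. 1 \<le> i \<and> i < j \<and> j \<le> 4 \<longrightarrow>
        (\<exists>X\<in>UT2. jordan_prod (to_rat_mat (A i)) (to_rat_mat (A j)) + to_rat_mat N
                    = to_rat_mat (X ^\<^sub>m 2)))"

definition jordan_D_quadruple :: "int mat \<Rightarrow> int mat set \<Rightarrow> bool" where
  "jordan_D_quadruple N Q \<longleftrightarrow>
     (\<exists>A. Q = A ` {1..4} \<and> jordan_D_property N A \<and>
          inj_on A {1..4} \<and> (\<forall>i\<in>{1..4}. A i \<noteq> 0\<^sub>m 2 2))"

end

theory Submission
  imports Defs
begin

text \<open>Write \<open>A i\<close> with diagonal \<open>a i, c i\<close> and corner \<open>b i\<close>, and put \<open>t i = a i + c i\<close>. The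
  Jordan product of two such matrices has diagonal \<open>a i * a j, c i * c j\<close> and corner
  \<open>(t i * b j + t j * b i) / 2\<close>, while an upper triangular square has diagonal
  \<open>x\<^sup>2, z\<^sup>2\<close> and corner \<open>y * (x + z)\<close>. The obstruction is 2-adic.

  Take \<open>N\<close> with diagonal \<open>1, 5\<close> modulo 8; the other case arises by exchanging the
  two diagonal entries. Since squares are \<open>0, 1, 4\<close> modulo 8, the products \<open>a i * a j\<close> lie in
  \<open>{0, 3, 7}\<close> and the products \<open>c i * c j\<close> in \<open>{3, 4, 7}\<close> modulo 8. Odd products are
  thus 3 modulo 4, which three odd numbers cannot achieve pairwise, so at least two of the
  \<open>a i\<close> and at least two of the \<open>c i\<close> are even. For \<open>c\<close> this forces \<open>c i = 2\<close> modulo 4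
  throughout.

  Whenever \<open>a i * a j\<close> is even, both \<open>x\<close> and \<open>z\<close> are odd, so \<open>y * (x + z)\<close> is even, and as the
  corner of \<open>N\<close> is odd, \<open>t i * b j + t j * b i\<close> is 2 modulo 4. If all \<open>a i\<close> are even, at least
  three of them are divisible by 4, so that their \<open>t i\<close> are 2 modulo 4; then their corners \<open>b i\<close>
  would have pairwise different parities. If some \<open>a i\<close> is odd, then two of the others are
  divisible by 8; pairing them with the odd one shows that their corners are even, and pairing
  them with each other gives a contradiction.\<close>

section \<open>Pairwise products modulo 8\<close>

lemma residue_mod_8: "(x::int) mod 8 \<in> {0, 1, 2, 3, 4, 5, 6, 7}"
proof -
  have "x mod 8 \<in> {0..<8}" by simp
  also have "{0..<8::int} = {0, 1, 2, 3, 4, 5, 6, 7}" by auto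
  finally show ?thesis .
qed

lemma square_mod_8: "(x::int)\<^sup>2 mod 8 \<in> {0, 1, 4}"
proof -
  have "x\<^sup>2 mod 8 = (x mod 8)\<^sup>2 mod 8" by (simp add: power_mod)
  then show ?thesis using residue_mod_8[of x] by auto
qed

lemma mod_8_if_add_1_square:
  fixes p :: int
  assumes "p + (8 * k + 1) = x\<^sup>2"
  shows "p mod 8 \<in> {0, 3, 7}"
proof -
  have "x\<^sup>2 = p + 1 + 8 * k" using assms by simp
  then have "(p mod 8 + 1) mod 8 \<in> {0, 1, 4}"
    using square_mod_8[of x] by (simp only: mod_mult_self2 mod_add_left_eq)
  then show ?thesis
    using residue_mod_8[of p] by auto
qed

lemma mod_8_if_add_5_square:
  fixes p :: int
  assumes "p + (8 * n + 5) = x\<^sup>2"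
  shows "p mod 8 \<in> {3, 4, 7}"
proof -
  have "x\<^sup>2 = p + 5 + 8 * n" using assms by simp
  then have "(p mod 8 + 5) mod 8 \<in> {0, 1, 4}"
    using square_mod_8[of x] by (simp only: mod_mult_self2 mod_add_left_eq)
  then show ?thesis
    using residue_mod_8[of p] by auto
qed

lemma even_mod_8: "even p \<Longrightarrow> p mod 8 \<in> {0, 2, 4, 6}" for p :: int
  by (simp, presburger)

lemma odd_mod_4: "odd p \<Longrightarrow> p mod 4 \<in> {1, 3}" for p :: int
  by (simp, presburger)

lemma odd_mod_4_eq_3: "odd p \<Longrightarrow> p mod 8 \<in> {0, 3, 4, 7} \<Longrightarrow> p mod 4 = 3" for p :: int
  by (simp, presburger)

lemma even_not_4_dvd_mod_8: "even p \<Longrightarrow> \<not> 4 dvd p \<Longrightarrow> p mod 8 \<in> {2, 6}" for p :: int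
  by (simp, presburger)

lemma even_of_mod_4_eq_2: "p mod 4 = 2 \<Longrightarrow> even p" for p :: int
  by presburger

lemma product_mod_4: "((p::int) * q) mod 4 = ((p mod 4) * (q mod 4)) mod 4"
  by (simp add: mod_mult_eq)

lemma product_mod_8: "((p::int) * q) mod 8 = ((p mod 8) * (q mod 8)) mod 8"
  by (simp add: mod_mult_eq)

text \<open>Modulo 4 an odd number is 1 or 3, so two of any three odd numbers agree there and have
  product 1.\<close>

lemma no_three_odd_with_products_3_mod_4:
  fixes p q r :: int
  assumes "odd p" "odd q" "odd r"
    and "(p * q) mod 4 = 3" "(p * r) mod 4 = 3" "(q * r) mod 4 = 3"
  shows False
proof -
  have "p mod 4 \<in> {1, 3}" "q mod 4 \<in> {1, 3}" "r mod 4 \<in> {1, 3}"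
    using assms(1-3) odd_mod_4 by blast+
  then show False
    using assms(4-6) unfolding product_mod_4[of p] product_mod_4[of q] by auto
qed

lemma two_even_of_odd_products_3_mod_4:
  fixes f :: "'i \<Rightarrow> int"
  assumes fin: "finite I" and card: "card I = 4"
    and prod: "\<And>i j. i \<in> I \<Longrightarrow> j \<in> I \<Longrightarrow> i \<noteq> j \<Longrightarrow> odd (f i * f j) \<Longrightarrow> (f i * f j) mod 4 = 3"
  shows "\<exists>i\<in>I. \<exists>j\<in>I. i \<noteq> j \<and> even (f i) \<and> even (f j)"
proof -
  define S where "S = {i\<in>I. odd (f i)}"
  have "card S \<le> 2"
  proof (rule ccontr)
    assume "\<not> card S \<le> 2"
    then obtain T where "T \<subseteq> S" "card T = 3"
      using obtain_subset_with_card_n[of 3 S] by auto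
    then obtain u v w where "{u, v, w} \<subseteq> S" "u \<noteq> v" "u \<noteq> w" "v \<noteq> w"
      by (metis card_3_iff)
    then show False
      using no_three_odd_with_products_3_mod_4[of "f u" "f v" "f w"] prod[of u v] prod[of u w] prod[of v w]
      unfolding S_def by auto
  qed
  then have "card (I - S) \<ge> 2"
    using card fin by (subst card_Diff_subset) (auto simp: S_def)
  then obtain T where "T \<subseteq> I - S" "card T = 2"
    using obtain_subset_with_card_n by metis
  then show ?thesis unfolding card_2_iff S_def by blast
qed

text \<open>A product that is 4 modulo 8 has either an odd factor or two factors that are 2 modulo 4.
  Two even entries exist and are of the second kind, so their products with an odd entry
  would be 2 modulo 4.\<close>

lemma all_2_mod_4_of_products_mod_8:
  fixes c :: "'i \<Rightarrow> int"
  assumes fin: "finite I" and card: "card I = 4"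
    and prod: "\<And>i j. i \<in> I \<Longrightarrow> j \<in> I \<Longrightarrow> i \<noteq> j \<Longrightarrow> (c i * c j) mod 8 \<in> {3, 4, 7}"
    and i: "i \<in> I"
  shows "c i mod 4 = 2"
proof -
  have even_even: "p mod 4 = 2"
    if "(p * q) mod 8 \<in> {3, 4, 7}" "even p" "even q" for p q :: int
  proof -
    have "p mod 8 \<in> {0,2,4,6}" "q mod 8 \<in> {0,2,4,6}"
      using that even_mod_8 by blast+
    then have "p mod 8 \<in> {2, 6}"
      using that(1) unfolding product_mod_8[of p] by auto
    then show ?thesis by (auto; presburger)
  qed
  have "(c i * c j) mod 4 = 3"
    if "i \<in> I" "j \<in> I" "i \<noteq> j" "odd (c i * c j)" for i j
    using odd_mod_4_eq_3[OF that(4)] prod[OF that(1-3)] by blast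
  then obtain j k where jk: "j \<in> I" "k \<in> I" "j \<noteq> k" "even (c j)" "even (c k)"
    using two_even_of_odd_products_3_mod_4[OF fin card, of c] by blast
  have j2: "c j mod 4 = 2"
    using even_even prod jk by blast
  have "even (c i)"
  proof (rule ccontr)
    assume odd: "odd (c i)"
    then have "c i mod 4 \<in> {1, 3}" by (rule odd_mod_4)
    then have "(c i * c j) mod 4 = 2"
      unfolding product_mod_4[of "c i"] j2 by auto
    moreover have "(c i * c j) mod 8 \<in> {3, 4, 7}"
      using prod i jk odd by metis
    moreover have "r mod 4 \<noteq> 2" if "r mod 8 \<in> {3, 4, 7}" for r :: int
      using that unfolding insert_iff empty_iff by presburger
    ultimately show False by blast
  qed
  then show ?thesis using even_even prod i jk by metis
qed

section \<open>The corner entries\<close>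

text \<open>This is the combinatorial core: \<open>a\<close> and \<open>c\<close> stand for the diagonals and \<open>b\<close> for the
  corners, and only the residues that are forced by the equations are kept. As \<open>c\<close> is 2 modulo 4,
  any entry with \<open>4 dvd a i\<close> has a trace that is 2 modulo 4. For two such entries the corner
  congruence reads \<open>2 * (b i + b j) = 2\<close> modulo 4, so their corners have different parities.
  Three such entries are therefore impossible, and so are two with even corners.\<close>

lemma no_four_residue_triples:
  fixes a b c :: "'i \<Rightarrow> int"
  assumes fin: "finite I" and card: "card I = 4"
    and a_prod: "\<And>i j. i \<in> I \<Longrightarrow> j \<in> I \<Longrightarrow> i \<noteq> j \<Longrightarrow> (a i * a j) mod 8 \<in> {0, 3, 7}"
    and c_prod: "\<And>i j. i \<in> I \<Longrightarrow> j \<in> I \<Longrightarrow> i \<noteq> j \<Longrightarrow> (c i * c j) mod 8 \<in> {3, 4, 7}"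
    and corner: "\<And>i j. i \<in> I \<Longrightarrow> j \<in> I \<Longrightarrow> i \<noteq> j \<Longrightarrow> even (a i * a j) \<Longrightarrow> even (c i * c j) \<Longrightarrow>
      ((a i + c i) * b j + (a j + c j) * b i) mod 4 = 2"
  shows False
proof -
  define t where "t i = a i + c i" for i
  have c2: "c i mod 4 = 2" if "i \<in> I" for i
    using all_2_mod_4_of_products_mod_8[OF fin card c_prod that] .
  have corner': "(t i * b j + t j * b i) mod 4 = 2"
    if "i \<in> I" "j \<in> I" "i \<noteq> j" "even (a i) \<or> even (a j)" for i j
  proof -
    have "even (c i)" using c2[OF that(1)] by presburger
    then show ?thesis using corner[OF that(1-3)] that(4) unfolding t_def by simp
  qed
  have t2: "t i mod 4 = 2" if "i \<in> I" "4 dvd a i" for i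
    using c2[OF that(1)] that(2) unfolding t_def by presburger
  have parity: "odd (b i + b j)" if "i \<in> I" "j \<in> I" "i \<noteq> j" "4 dvd a i" "4 dvd a j" for i j
  proof
    assume ev: "even (b i + b j)"
    \<comment> \<open>With both traces 2 modulo 4, equal parities would make the corner sum divisible by 4.\<close>
    define r s where "r = t i div 4" and "s = t j div 4"
    have r: "t i = 4 * r + 2" and s: "t j = 4 * s + 2"
      unfolding r_def s_def
      using t2[OF that(1,4)] t2[OF that(2,5)] mult_div_mod_eq[of 4 "t i"] mult_div_mod_eq[of 4 "t j"]
      by linarith+
    obtain w where w: "b i + b j = 2 * w" using ev by (elim evenE)
    have "t i * b j + t j * b i = 4 * (r * b j + s * b i) + 2 * (b i + b j)"
      unfolding r s by (simp add: algebra_simps)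
    also have "\<dots> = 4 * (r * b j + s * b i + w)"
      unfolding w by simp
    finally have "4 dvd t i * b j + t j * b i" by simp
    moreover have "even (a i)" using that(4) by presburger
    then have "(t i * b j + t j * b i) mod 4 = 2"
      using corner'[of i j] that by blast
    ultimately show False by simp
  qed
  show False
  proof (cases "\<exists>i\<in>I. odd (a i)")
    case True
    then obtain i where i: "i \<in> I" "odd (a i)" by blast
    have even_entry: "4 dvd a j \<and> even (b j)" if j: "j \<in> I" "even (a j)" for j
    proof -
      have ij: "i \<noteq> j" using i j by auto
      have "even (a i * a j)" using j by simp
      then have "8 dvd a i * a j"
        using even_mod_8 a_prod[OF i(1) j(1) ij] by fastforce
      moreover have "coprime (2 ^ 3) (a i)"
        using i(2) by (subst coprime_power_left_iff) simp
      ultimately have "8 dvd a j" using coprime_dvd_mult_right_iff[of 8 "a i" "a j"] by simp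
      then have d4: "4 dvd a j" by presburger
      have "even (c i)" using c2[OF i(1)] by presburger
      then have "odd (t i)" using i unfolding t_def by simp
      moreover have "even (t j)" using t2[OF j(1) d4] by presburger
      moreover have "even (t i * b j + t j * b i)"
        using corner'[OF i(1) j(1) ij] j(2) even_of_mod_4_eq_2 by blast
      ultimately show ?thesis using d4 by simp
    qed
    have "(a i * a j) mod 4 = 3"
      if "i \<in> I" "j \<in> I" "i \<noteq> j" "odd (a i * a j)" for i j
      using odd_mod_4_eq_3[OF that(4)] a_prod[OF that(1-3)] by blast
    then obtain j k where "j \<in> I" "k \<in> I" "j \<noteq> k" "even (a j)" "even (a k)"
      using two_even_of_odd_products_3_mod_4[OF fin card, of a] by blast
    then show False using parity[of j k] even_entry by auto
  next
    case False
    \<comment> \<open>Two even entries not divisible by 4 would have product 4 modulo 8, so at most one occurs.\<close>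
    define T where "T = {i\<in>I. \<not> 4 dvd a i}"
    have "i = j" if "i \<in> T" "j \<in> T" for i j
    proof (rule ccontr)
      assume ne: "i \<noteq> j"
      have "a i mod 8 \<in> {2, 6}" "a j mod 8 \<in> {2, 6}"
        using that False even_not_4_dvd_mod_8 unfolding T_def by blast+
      then have "(a i * a j) mod 8 = 4"
        unfolding product_mod_8[of "a i"] by auto
      then show False
        using a_prod[of i j] that ne unfolding T_def by auto
    qed
    then have "card T \<le> 1"
      using fin by (simp add: card_le_Suc0_iff_eq T_def)
    then have "card (I - T) \<ge> 3"
      using card fin by (subst card_Diff_subset) (auto simp: T_def)
    then obtain U where "U \<subseteq> I - T" "card U = 3"
      using obtain_subset_with_card_n by metis
    then obtain u v w where uvw: "{u, v, w} \<subseteq> I - T" "u \<noteq> v" "u \<noteq> w" "v \<noteq> w"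
      by (metis card_3_iff)
    then have "odd (b u + b v)" "odd (b u + b w)" "odd (b v + b w)"
      using parity unfolding T_def by auto
    then show False by presburger
  qed
qed

text \<open>The corner congruence is the step that uses both diagonals: even products make both
  diagonal squares odd, hence \<open>x + z\<close> even and the right-hand side divisible by 4, while \<open>2 * (2 * m + 1)\<close> is 2 modulo 4.\<close>

lemma no_four_triangular_squares:
  fixes a b c :: "nat \<Rightarrow> int" and k m n :: int
  assumes sq: "\<And>i j. 1 \<le> i \<Longrightarrow> i < j \<Longrightarrow> j \<le> 4 \<Longrightarrow> \<exists>x y z.
      a i * a j + (8 * k + 1) = x\<^sup>2 \<and> c i * c j + (8 * n + 5) = z\<^sup>2 \<and>
      (a i + c i) * b j + (a j + c j) * b i + 2 * (2 * m + 1) = 2 * (y * (x + z))"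
  shows False
proof -
  have sq': "\<exists>x y z. a i * a j + (8 * k + 1) = x\<^sup>2 \<and> c i * c j + (8 * n + 5) = z\<^sup>2 \<and>
      (a i + c i) * b j + (a j + c j) * b i + 2 * (2 * m + 1) = 2 * (y * (x + z))"
    if "i \<in> {1..4}" "j \<in> {1..4}" "i \<noteq> j" for i j
  proof (cases "i < j")
    case True
    then show ?thesis using sq that by simp
  next
    case False
    then show ?thesis using sq[of j i] that by (simp add: ac_simps)
  qed
  show False
  proof (rule no_four_residue_triples[of "{1..4::nat}" a c b])
    fix i j :: nat
    assume ij: "i \<in> {1..4}" "j \<in> {1..4}" "i \<noteq> j"
    obtain x y z where x: "a i * a j + (8 * k + 1) = x\<^sup>2" and z: "c i * c j + (8 * n + 5) = z\<^sup>2"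
      and y: "(a i + c i) * b j + (a j + c j) * b i + 2 * (2 * m + 1) = 2 * (y * (x + z))"
      using sq'[OF ij] by blast
    show "(a i * a j) mod 8 \<in> {0, 3, 7}"
      using x by (rule mod_8_if_add_1_square)
    show "(c i * c j) mod 8 \<in> {3, 4, 7}"
      using z by (rule mod_8_if_add_5_square)
    assume ev: "even (a i * a j)" "even (c i * c j)"
    have "odd (x\<^sup>2)" "odd (z\<^sup>2)"
      unfolding x[symmetric] z[symmetric] using ev by simp_all
    then have "even (x + z)" by simp
    then obtain w where "x + z = 2 * w" by (elim evenE)
    then have "(a i + c i) * b j + (a j + c j) * b i = 4 * (y * w - m - 1) + 2"
      using y by (simp add: algebra_simps)
    then show "((a i + c i) * b j + (a j + c j) * b i) mod 4 = 2"
      by presburger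
  qed auto
qed

section \<open>Passing to the entries\<close>

lemma UT2_entries:
  assumes "A \<in> UT2"
  shows "A \<in> carrier_mat 2 2" "A $$ (1, 0) = 0"
  using assms unfolding UT2_def upper_triangular_def by auto

text \<open>Doubling the corner equation clears the only denominator, so all three equations descend
  to the integers.\<close>

lemma jordan_square_entries:
  assumes A: "A \<in> UT2" and B: "B \<in> UT2" and X: "X \<in> UT2" and N: "N \<in> carrier_mat 2 2"
    and eq: "jordan_prod (to_rat_mat A) (to_rat_mat B) + to_rat_mat N = to_rat_mat (X ^\<^sub>m 2)"
  shows "A $$ (0,0) * B $$ (0,0) + N $$ (0,0) = (X $$ (0,0))\<^sup>2"
    and "A $$ (1,1) * B $$ (1,1) + N $$ (1,1) = (X $$ (1,1))\<^sup>2"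
    and "(A $$ (0,0) + A $$ (1,1)) * B $$ (0,1) + (B $$ (0,0) + B $$ (1,1)) * A $$ (0,1)
          + 2 * N $$ (0,1) = 2 * (X $$ (0,1) * (X $$ (0,0) + X $$ (1,1)))"
proof -
  have zeros: "A $$ (Suc 0, 0) = 0" "B $$ (Suc 0, 0) = 0" "X $$ (Suc 0, 0) = 0"
    using UT2_entries(2)[OF A] UT2_entries(2)[OF B] UT2_entries(2)[OF X] by simp_all
  have dims: "dim_row A = 2" "dim_col A = 2" "dim_row B = 2" "dim_col B = 2"
    "dim_row X = 2" "dim_col X = 2" "dim_row N = 2" "dim_col N = 2"
    using UT2_entries(1)[OF A] UT2_entries(1)[OF B] UT2_entries(1)[OF X] N by auto
  have X2: "X ^\<^sub>m 2 = X * X"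
    using UT2_entries(1)[OF X] by (simp add: numeral_2_eq_2)
  have ent: "(jordan_prod (to_rat_mat A) (to_rat_mat B) + to_rat_mat N) $$ p = to_rat_mat (X * X) $$ p"
    for p using eq X2 by simp
  have two: "{0..<2::nat} = {0, 1}" by auto
  have "rat_of_int (A $$ (0,0) * B $$ (0,0) + N $$ (0,0)) = rat_of_int ((X $$ (0,0))\<^sup>2)"
    using ent[of "(0,0)"] dims
    by (simp add: jordan_prod_def scalar_prod_def two zeros power2_eq_square)
  then show "A $$ (0,0) * B $$ (0,0) + N $$ (0,0) = (X $$ (0,0))\<^sup>2"
    by (simp only: of_int_eq_iff)
  have "rat_of_int (A $$ (1,1) * B $$ (1,1) + N $$ (1,1)) = rat_of_int ((X $$ (1,1))\<^sup>2)"
    using ent[of "(1,1)"] dims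
    by (simp add: jordan_prod_def scalar_prod_def two zeros power2_eq_square)
  then show "A $$ (1,1) * B $$ (1,1) + N $$ (1,1) = (X $$ (1,1))\<^sup>2"
    by (simp only: of_int_eq_iff)
  have "rat_of_int ((A $$ (0,0) + A $$ (1,1)) * B $$ (0,1) + (B $$ (0,0) + B $$ (1,1)) * A $$ (0,1)
          + 2 * N $$ (0,1)) = rat_of_int (2 * (X $$ (0,1) * (X $$ (0,0) + X $$ (1,1))))"
    using ent[of "(0,1)"] dims
    by (simp add: jordan_prod_def scalar_prod_def two zeros field_simps)
  then show "(A $$ (0,0) + A $$ (1,1)) * B $$ (0,1) + (B $$ (0,0) + B $$ (1,1)) * A $$ (0,1)
          + 2 * N $$ (0,1) = 2 * (X $$ (0,1) * (X $$ (0,0) + X $$ (1,1)))"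
    by (simp only: of_int_eq_iff)
qed

theorem proposition12:
  fixes k m n :: int and N :: "int mat"
  assumes "N = mat_of_rows_list 2 [[8 * k + 1, 2 * m + 1], [0, 8 * n + 5]] \<or>
           N = mat_of_rows_list 2 [[8 * k + 5, 2 * m + 1], [0, 8 * n + 1]]"
  shows "(\<nexists>A. jordan_D_property N A) \<and> (\<nexists>Q. jordan_D_quadruple N Q)"
proof -
  have N: "N \<in> carrier_mat 2 2" and N01: "N $$ (0,1) = 2 * m + 1"
    and diag: "N $$ (0,0) = 8 * k + 1 \<and> N $$ (1,1) = 8 * n + 5 \<or>
      N $$ (0,0) = 8 * k + 5 \<and> N $$ (1,1) = 8 * n + 1"
    using assms by (auto simp: mat_of_rows_list_def)
  have no: "\<not> jordan_D_property N A" for A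
  proof
    assume "jordan_D_property N A"
    then have UT: "\<And>i. i \<in> {1..4} \<Longrightarrow> A i \<in> UT2"
      and ex: "\<And>i j. 1 \<le> i \<Longrightarrow> i < j \<Longrightarrow> j \<le> 4 \<Longrightarrow>
        \<exists>X\<in>UT2. jordan_prod (to_rat_mat (A i)) (to_rat_mat (A j)) + to_rat_mat N
                    = to_rat_mat (X ^\<^sub>m 2)"
      unfolding jordan_D_property_def by blast+
    define a b c where "a i = A i $$ (0,0)" and "b i = A i $$ (0,1)" and "c i = A i $$ (1,1)" for i
    have sq: "\<exists>x y z. a i * a j + N $$ (0,0) = x\<^sup>2 \<and> c i * c j + N $$ (1,1) = z\<^sup>2 \<and>
      (a i + c i) * b j + (a j + c j) * b i + 2 * (2 * m + 1) = 2 * (y * (x + z))"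
      if ij: "1 \<le> i" "i < j" "j \<le> 4" for i j
    proof -
      have "A i \<in> UT2" "A j \<in> UT2" using UT ij by auto
      then show ?thesis
        using ex[OF ij] jordan_square_entries[of "A i" "A j" _ N] N
        unfolding a_def b_def c_def N01[symmetric] by blast
    qed
    show False
      using diag
    proof (elim disjE conjE)
      assume "N $$ (0,0) = 8 * k + 1" "N $$ (1,1) = 8 * n + 5"
      then show False
        using no_four_triangular_squares[of a k c n b m] sq by simp
    next
      assume d: "N $$ (0,0) = 8 * k + 5" "N $$ (1,1) = 8 * n + 1"
      \<comment> \<open>The system is symmetric under exchanging the two diagonals, because the corner equation
        involves only traces.\<close>
      have "\<exists>x y z. c i * c j + (8 * n + 1) = x\<^sup>2 \<and> a i * a j + (8 * k + 5) = z\<^sup>2 \<and>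
        (c i + a i) * b j + (c j + a j) * b i + 2 * (2 * m + 1) = 2 * (y * (x + z))"
        if "1 \<le> i" "i < j" "j \<le> 4" for i j
        using sq[OF that] unfolding d by (metis add.commute)
      then show False
        using no_four_triangular_squares[of c n a k b m] by blast
    qed
  qed
  then show ?thesis unfolding jordan_D_quadruple_def by blast
qed

end
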